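(* Let $(A,\mu)\in\mathcal C$ and let $M$ be an $A$-bimodule. Let $\beta:M\to A$ and $\alpha:M\otimes M\to M$ be linear maps. Define new products on $M$ by setting, for all $m,m'\in M$, $$m\succ m':=\beta(m)\cdot m',\quad m\prec m':=m\cdot\beta(m'),\quad m\vee m':=\alpha(m\otimes m'),$$ $$m\star m':=m\succ m'+m\prec m'+m\vee m'.$$ If $\beta:(M,\star)\to(A,\mu)$ is an algebra homomorphism and $(M,\star)\in\mathcal C$, then $(M,\prec,\succ,\vee)$ is a $\mathcal C$-NS-algebra.
   Context: Fix a commutative ring $R$; all modules, tensor products and linear maps are over $R$. An algebra $(A,\mu_1,\dots,\mu_s)$ is an $R$-module $A$ with linear maps (products) $\mu_i:A\otimes A\to A$; no associativity or unit is assumed. For a single product write $ab=\mu(a\otimes b)$. An algebra homomorphism is a linear map respecting the products. Fix a collection of multilinear relations $\mathcal R_1=0,\dots,\mathcal R_k=0$ in one binary product: an $n$-linear relation is an $R$-linear combination of parenthesized (non-associative) monomials in $x_1,\dots,x_n$, each variable occurring exactly once in each monomial. $\mathcal C$ is the category of all algebras $(A,\mu)$ in which these relations hold for all substitutions of elements of $A$; $(A,\mu)\in\mathcal C$ means that $(A,\mu)$ satisfies all of them. Bimodule: let $(A,\mu)\in\mathcal C$ and let $M$ be an $R$-module with linear maps $l,r:A\to\mathrm{End}(M)$, written $a\cdot m:=l(a)(m)$ and $m\cdot a:=r(a)(m)$ (left and right actions). $(M,l,r)$, or simply $M$, is an $A$-bimodule if $A\oplus M$ with the product $(a,m)*(a',m'):=(aa',a\cdot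 m'+m\cdot a')$ belongs to $\mathcal C$. $\mathcal C$-NS-algebra: an algebra $(A,\prec,\succ,\vee)$ with three products such that $(A\oplus A,\boxtimes)\in\mathcal C$, where $(a,x)\boxtimes(a',x'):=(a\star a',\,a\succ x'+x\prec a')$ and $a\star a':=a\succ a'+a\prec a'+a\vee a'$. *)

theory Defs
  imports "HOL-Analysis.Product_Vector" "HOL-Library.Poly_Mapping"
begin

text \<open>
  Modules are given by the scalar multiplication of the library locale \<^locale>\<open>module\<close>,
  direct sums by product types with \<^const>\<open>module_prod.scale\<close>. A linear map out of a tensor
  product is given in curried form by the corresponding bilinear map.
\<close>

definition bilinear_map ::
  "('r::comm_ring_1 \<Rightarrow> 'a::ab_group_add \<Rightarrow> 'a) \<Rightarrow> ('r \<Rightarrow> 'b::ab_group_add \<Rightarrow> 'b) \<Rightarrow>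
   ('r \<Rightarrow> 'c::ab_group_add \<Rightarrow> 'c) \<Rightarrow> ('a \<Rightarrow> 'b \<Rightarrow> 'c) \<Rightarrow> bool"
  where "bilinear_map sA sB sC f \<longleftrightarrow>
    (\<forall>a. module_hom sB sC (\<lambda>b. f a b)) \<and> (\<forall>b. module_hom sA sC (\<lambda>a. f a b))"

definition algebra_with ::
  "('r::comm_ring_1 \<Rightarrow> 'a::ab_group_add \<Rightarrow> 'a) \<Rightarrow> ('a \<Rightarrow> 'a \<Rightarrow> 'a) list \<Rightarrow> bool"
  where "algebra_with s \<mu>s \<longleftrightarrow> module s \<and> (\<forall>\<mu>\<in>set \<mu>s. bilinear_map s s s \<mu>)"

definition algebra_homomorphism ::
  "('r::comm_ring_1 \<Rightarrow> 'a::ab_group_add \<Rightarrow> 'a) \<Rightarrow> ('a \<Rightarrow> 'a \<Rightarrow> 'a) \<Rightarrow>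
   ('r \<Rightarrow> 'b::ab_group_add \<Rightarrow> 'b) \<Rightarrow> ('b \<Rightarrow> 'b \<Rightarrow> 'b) \<Rightarrow> ('a \<Rightarrow> 'b) \<Rightarrow> bool"
  where "algebra_homomorphism sA \<mu> sB \<nu> f \<longleftrightarrow>
    module_hom sA sB f \<and> (\<forall>a a'. f (\<mu> a a') = \<nu> (f a) (f a'))"

text \<open>
  Parenthesized monomials in the variables \<open>x\<^sub>i\<close>. Their \<open>R\<close>-linear combinations are the
  finitely supported functions from monomials to scalars.
\<close>

datatype magma_monomial = Var nat | Mult magma_monomial magma_monomial

primrec variables :: "magma_monomial \<Rightarrow> nat list" where
  "variables (Var i) = [i]"
| "variables (Mult s t) = variables s @ variables t"

primrec eval_monomial :: "('a \<Rightarrow> 'a \<Rightarrow> 'a) \<Rightarrow> (nat \<Rightarrow> 'a) \<Rightarrow> magma_monomial \<Rightarrow> 'a" where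
  "eval_monomial \<mu> x (Var i) = x i"
| "eval_monomial \<mu> x (Mult s t) = \<mu> (eval_monomial \<mu> x s) (eval_monomial \<mu> x t)"

definition multilinear :: "nat \<Rightarrow> (magma_monomial \<Rightarrow>\<^sub>0 'r::comm_ring_1) \<Rightarrow> bool" where
  "multilinear n p \<longleftrightarrow>
    (\<forall>t\<in>Poly_Mapping.keys p. distinct (variables t) \<and> set (variables t) = {1..n})"

definition satisfies ::
  "('r::comm_ring_1 \<Rightarrow> 'a::ab_group_add \<Rightarrow> 'a) \<Rightarrow> ('a \<Rightarrow> 'a \<Rightarrow> 'a) \<Rightarrow>
   (magma_monomial \<Rightarrow>\<^sub>0 'r) \<Rightarrow> bool"
  where "satisfies s \<mu> p \<longleftrightarrow>
    (\<forall>x. (\<Sum>t\<in>Poly_Mapping.keys p. s (Poly_Mapping.lookup p t) (eval_monomial \<mu> x t)) = 0)"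

text \<open>Membership in the category \<open>\<C>\<close> determined by the relations \<open>rels\<close>.\<close>

definition in_category ::
  "(magma_monomial \<Rightarrow>\<^sub>0 'r::comm_ring_1) list \<Rightarrow> ('r \<Rightarrow> 'a::ab_group_add \<Rightarrow> 'a) \<Rightarrow>
   ('a \<Rightarrow> 'a \<Rightarrow> 'a) \<Rightarrow> bool"
  where "in_category rels s \<mu> \<longleftrightarrow> algebra_with s [\<mu>] \<and> (\<forall>p\<in>set rels. satisfies s \<mu> p)"

text \<open>
  The right action is \<open>r a m = m \<cdot> a\<close>, with the algebra element as first argument.
  Bilinearity of \<open>l\<close> and \<open>r\<close> says that they are linear maps from \<open>A\<close> to \<open>End(M)\<close>.
\<close>

definition bimodule ::
  "(magma_monomial \<Rightarrow>\<^sub>0 'r::comm_ring_1) list \<Rightarrow> ('r \<Rightarrow> 'a::ab_group_add \<Rightarrow> 'a) \<Rightarrow>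
   ('a \<Rightarrow> 'a \<Rightarrow> 'a) \<Rightarrow> ('r \<Rightarrow> 'm::ab_group_add \<Rightarrow> 'm) \<Rightarrow> ('a \<Rightarrow> 'm \<Rightarrow> 'm) \<Rightarrow>
   ('a \<Rightarrow> 'm \<Rightarrow> 'm) \<Rightarrow> bool"
  where "bimodule rels sA \<mu> sM l r \<longleftrightarrow>
    in_category rels sA \<mu> \<and> module sM \<and> bilinear_map sA sM sM l \<and> bilinear_map sA sM sM r \<and>
    in_category rels (module_prod.scale sA sM) (\<lambda>(a, m) (a', m'). (\<mu> a a', l a m' + r a' m))"

definition ns_star ::
  "('a::ab_group_add \<Rightarrow> 'a \<Rightarrow> 'a) \<Rightarrow> ('a \<Rightarrow> 'a \<Rightarrow> 'a) \<Rightarrow> ('a \<Rightarrow> 'a \<Rightarrow> 'a) \<Rightarrow> 'a \<Rightarrow> 'a \<Rightarrow> 'a"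
  where "ns_star prec succ vee a a' = succ a a' + prec a a' + vee a a'"

definition ns_algebra ::
  "(magma_monomial \<Rightarrow>\<^sub>0 'r::comm_ring_1) list \<Rightarrow> ('r \<Rightarrow> 'a::ab_group_add \<Rightarrow> 'a) \<Rightarrow>
   ('a \<Rightarrow> 'a \<Rightarrow> 'a) \<Rightarrow> ('a \<Rightarrow> 'a \<Rightarrow> 'a) \<Rightarrow> ('a \<Rightarrow> 'a \<Rightarrow> 'a) \<Rightarrow> bool"
  where "ns_algebra rels s prec succ vee \<longleftrightarrow>
    algebra_with s [prec, succ, vee] \<and>
    in_category rels (module_prod.scale s s)
      (\<lambda>(a, x) (a', x'). (ns_star prec succ vee a a', succ a x' + prec x a'))"

end

theory Submission
  imports Defs
begin

text \<open>
  The projection \<open>M \<oplus> M \<rightarrow> M\<close>, \<open>(m, x) \<mapsto> m\<close>, is a homomorphism to \<open>(M, \<star>)\<close>, and the map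
  \<open>(m, x) \<mapsto> (\<beta> m, x)\<close> is a homomorphism to the semidirect product \<open>A \<oplus> M\<close>. Both targets lie in
  \<open>\<C>\<close> and the two maps are jointly injective, so the relations pull back to \<open>M \<oplus> M\<close>.
\<close>

lemma eval_monomial_hom:
  assumes "\<And>a a'. f (\<mu> a a') = \<nu> (f a) (f a')"
  shows "f (eval_monomial \<mu> x t) = eval_monomial \<nu> (f \<circ> x) t"
  by (induction t) (simp_all add: assms)

text \<open>Linearity moves \<open>f\<close> past the sum and the scalars, multiplicativity past
  each monomial. What results is the value of \<open>p\<close> in the target at the substitution
  \<open>f \<circ> x\<close>.\<close>

lemma algebra_homomorphism_relation_eq_0:
  assumes "algebra_homomorphism sA \<mu> sB \<nu> f" and "satisfies sB \<nu> p"
  shows "f (\<Sum>t\<in>Poly_Mapping.keys p. sA (Poly_Mapping.lookup p t) (eval_monomial \<mu> x t)) = 0"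
proof -
  interpret module_hom sA sB f
    using assms(1) by (simp add: algebra_homomorphism_def)
  have "f (eval_monomial \<mu> x t) = eval_monomial \<nu> (f \<circ> x) t" for t
    using assms(1) by (intro eval_monomial_hom) (simp add: algebra_homomorphism_def)
  then show ?thesis
    using assms(2) by (simp add: sum scale satisfies_def)
qed

text \<open>Each value of \<open>p\<close> lies in the kernels of both homomorphisms, and these
  kernels intersect trivially.\<close>

lemma satisfies_jointly_injective:
  assumes f: "algebra_homomorphism sA \<mu> sB \<nu> f" and g: "algebra_homomorphism sA \<mu> sC \<rho> g"
    and "satisfies sB \<nu> p" and "satisfies sC \<rho> p"
    and "\<And>a. f a = 0 \<Longrightarrow> g a = 0 \<Longrightarrow> a = 0"
  shows "satisfies sA \<mu> p"
  unfolding satisfies_def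
  using assms(5) algebra_homomorphism_relation_eq_0[OF f assms(3)]
    algebra_homomorphism_relation_eq_0[OF g assms(4)] by blast

lemma bilinear_map_compose:
  assumes f: "bilinear_map sA sB sC f" and h: "module_hom sD sA h"
  shows "bilinear_map sD sB sC (\<lambda>d. f (h d))"
  unfolding bilinear_map_def
proof (intro conjI allI)
  show "module_hom sB sC (f (h d))" for d
    using f by (simp add: bilinear_map_def)
  show "module_hom sD sC (\<lambda>d. f (h d) b)" for b
    using module_hom_compose[OF h, of sC "\<lambda>a. f a b"] f
    by (simp add: bilinear_map_def comp_def)
qed

lemma bilinear_map_swap:
  "bilinear_map sA sB sC f \<Longrightarrow> bilinear_map sB sA sC (\<lambda>b a. f a b)"
  by (simp add: bilinear_map_def)

lemma module_prod_scale:
  assumes "module s" and "module s'"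
  shows "module (module_prod.scale s s')"
proof -
  interpret module_prod s s'
    by (intro module_prod.intro module_pair.intro assms)
  show ?thesis ..
qed

text \<open>Membership in the category also requires a bilinear product; this is checked
  componentwise rather than pulled back.\<close>

lemma bilinear_map_ns_product:
  assumes "bilinear_map s s s star" and "bilinear_map s s s prec" and "bilinear_map s s s succ"
    and "module s"
  shows "bilinear_map (module_prod.scale s s) (module_prod.scale s s) (module_prod.scale s s)
    (\<lambda>(a, x) (a', x'). (star a a', succ a x' + prec x a'))"
proof -
  interpret module_prod s s
    by (intro module_prod.intro module_pair.intro assms)
  show ?thesis
    using assms module_prod_scale[OF assms(4,4)]
    by (auto simp: bilinear_map_def module_hom_iff scale_def m1.scale_right_distrib)
qed

theorem theorem3p10:
  fixes rels :: "(magma_monomial \<Rightarrow>\<^sub>0 'r::comm_ring_1) list"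
    and sA :: "'r \<Rightarrow> 'a::ab_group_add \<Rightarrow> 'a" and \<mu> :: "'a \<Rightarrow> 'a \<Rightarrow> 'a"
    and sM :: "'r \<Rightarrow> 'm::ab_group_add \<Rightarrow> 'm" and l r :: "'a \<Rightarrow> 'm \<Rightarrow> 'm"
    and \<beta> :: "'m \<Rightarrow> 'a" and \<alpha> prec succ vee :: "'m \<Rightarrow> 'm \<Rightarrow> 'm"
  assumes "\<forall>p\<in>set rels. \<exists>n. multilinear n p"
    and "in_category rels sA \<mu>"
    and "bimodule rels sA \<mu> sM l r"
    and "module_hom sM sA \<beta>"
    and "bilinear_map sM sM sM \<alpha>"
    and "\<And>m m'. succ m m' = l (\<beta> m) m'"
    and "\<And>m m'. prec m m' = r (\<beta> m') m"
    and "\<And>m m'. vee m m' = \<alpha> m m'"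
    and "algebra_homomorphism sM (ns_star prec succ vee) sA \<mu> \<beta>"
    and "in_category rels sM (ns_star prec succ vee)"
  shows "ns_algebra rels sM prec succ vee"
proof -
  let ?star = "ns_star prec succ vee"
  let ?box = "\<lambda>(a, x) (a', x'). (?star a a', succ a x' + prec x a')"
  let ?sMM = "module_prod.scale sM sM" and ?sAM = "module_prod.scale sA sM"
  let ?semi = "\<lambda>(a, m) (a', m'). (\<mu> a a', l a m' + r a' m)"
  have M: "module sM" and l: "bilinear_map sA sM sM l" and r: "bilinear_map sA sM sM r"
    and semi: "in_category rels ?sAM ?semi"
    using assms(3) by (auto simp: bimodule_def)
  have A: "module sA"
    using assms(2) by (simp add: in_category_def algebra_with_def)
  \<comment> \<open>Equations of functions, so that the products can be rewritten where they occur
    unapplied, as in \<open>bilinear_map\<close>.\<close>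
  have succ_eq: "succ = (\<lambda>m. l (\<beta> m))" and prec_eq: "prec = (\<lambda>m m'. r (\<beta> m') m)"
    and vee_eq: "vee = \<alpha>"
    by (intro ext, rule assms)+
  \<comment> \<open>The swap for \<open>prec\<close> is due to \<open>r\<close> taking the algebra
    element first, whereas \<open>prec\<close> applies \<beta> to its second argument.\<close>
  have bil: "bilinear_map sM sM sM succ" "bilinear_map sM sM sM prec" "bilinear_map sM sM sM vee"
    using bilinear_map_compose[OF l assms(4)]
      bilinear_map_swap[OF bilinear_map_compose[OF r assms(4)]] assms(5)
    by (simp_all add: succ_eq prec_eq vee_eq)
  have star: "bilinear_map sM sM sM ?star"
    using assms(10) by (simp add: in_category_def algebra_with_def)
  interpret MM: module_prod sM sM
    by (intro module_prod.intro module_pair.intro M)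
  interpret AM: module_prod sA sM
    by (intro module_prod.intro module_pair.intro A M)
  have fst_hom: "algebra_homomorphism ?sMM ?box sM ?star fst"
    using M module_prod_scale[OF M M]
    by (auto simp: algebra_homomorphism_def module_hom_iff MM.scale_def)
  \<comment> \<open>First components agree because \<beta> is multiplicative for
    \<open>?star\<close>; second components agree because \<open>succ\<close> and
    \<open>prec\<close> are the actions of A on M along \<beta>.\<close>
  have \<beta>_hom: "algebra_homomorphism ?sMM ?box ?sAM ?semi (map_prod \<beta> id)"
    using assms(9) module_prod_scale[OF M M] module_prod_scale[OF A M]
    by (auto simp: algebra_homomorphism_def module_hom_iff MM.scale_def AM.scale_def
        succ_eq prec_eq)
  have "satisfies ?sMM ?box p" if "p \<in> set rels" for p
  proof (rule satisfies_jointly_injective[OF fst_hom \<beta>_hom])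
    show "satisfies sM ?star p" "satisfies ?sAM ?semi p"
      using that assms(10) semi by (auto simp: in_category_def)
  \<comment> \<open>Joint injectivity: \<open>fst\<close> kills only pairs with first entry 0, and
    \<open>map_prod \<beta> id\<close> leaves the second entry unchanged.\<close>
  qed (auto simp: prod_eq_iff)
  then show ?thesis
    using bilinear_map_ns_product[OF star bil(2,1) M] bil M module_prod_scale[OF M M]
    by (simp add: ns_algebra_def in_category_def algebra_with_def)
qed

end
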